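(* Consider the linear symmetric case with $M$ incumbent service providers (SPs) and no entrants: $P(x)=1-x$, $g(x)=x$, and each SP has licensed bandwidth $B_t/M$, where $B_t>0$ is the total licensed bandwidth. In the case of infinite unlicensed spectrum ($W\to\infty$), if we also assume an infinite number of incumbent SPs, i.e. $M\to\infty$ (with $B_t$ fixed), the social welfare gap between the profit optimal and welfare optimal settings is given by $$\mathrm{Gap}=\frac{1}{2+\max\{2,B_t\}}.$$
   Context: $P$ is the inverse demand function and $g$ the congestion function. Customers are infinitesimal; $\alpha\in[0,1]$ is the average fraction of time that customers are served on the unlicensed band, and is a common value for all SPs. For given $\alpha$, each SP $i$ announces a price $p_i\ge 0$ for its bundled service and serves a customer mass $x_i\ge0$. With $B_i=B_t/M$, the delivered price of SP $i$ is $$d_i(p_i,\mathbf{x})=p_i+(1-\alpha)g\left(\tfrac{(1-\alpha)x_i}{B_i}\right)+\alpha g\left(\tfrac{\alpha\sum_{j}x_j}{W}\right).$$ Given prices, $\mathbf{x}$ satisfies the Wardrop conditions: $d_i(p_i,\mathbf{x})\ge P(\sum_jx_j)$ for all $i$, with equality whenever $x_i>0$. SP $i$'s profit is $p_ix_i$. Prices are at the symmetric Nash equilibrium (equal prices; no SP can increase its profit by unilaterally changing its price). With $Q=\sum_jx_j$ at equilibrium, social welfare is $SW=\int_0^Q(P(q)-P(Q))\,dq+\sum_jp_jx_j$. For fixed $M$, take the limits as $W\to\infty$ of the equilibrium profits and social welfare as functions of $\alpha$. The profit optimal setting uses the $\alpha$ maximizing the (limiting) profit of the SPs; the welfare optimal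 setting uses the $\alpha$ maximizing the (limiting) social welfare. The gap is the social welfare in the welfare optimal setting minus the social welfare in the profit optimal setting, in the limit $M\to\infty$. *)

theory Defs
  imports "HOL-Analysis.Analysis"
begin

text \<open>
  \<open>P\<close> is the inverse demand function, \<open>g\<close> the congestion function, \<open>B i\<close> the licensed
  bandwidth of SP \<open>i\<close>, \<open>W\<close> the unlicensed bandwidth. The \<open>M\<close> SPs are indexed by \<open>{..<M}\<close>;
  values of price and mass vectors at other indices are irrelevant.
\<close>

definition delivered_price ::
  "(real \<Rightarrow> real) \<Rightarrow> nat \<Rightarrow> (nat \<Rightarrow> real) \<Rightarrow> real \<Rightarrow> real \<Rightarrow> (nat \<Rightarrow> real) \<Rightarrow> (nat \<Rightarrow> real) \<Rightarrow> nat \<Rightarrow> real"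
  where
  "delivered_price g M B W \<alpha> p x i =
     p i + (1 - \<alpha>) * g ((1 - \<alpha>) * x i / B i) + \<alpha> * g (\<alpha> * (\<Sum>j<M. x j) / W)"

definition wardrop ::
  "(real \<Rightarrow> real) \<Rightarrow> (real \<Rightarrow> real) \<Rightarrow> nat \<Rightarrow> (nat \<Rightarrow> real) \<Rightarrow> real \<Rightarrow> real \<Rightarrow>
   (nat \<Rightarrow> real) \<Rightarrow> (nat \<Rightarrow> real) \<Rightarrow> bool"
  where
  "wardrop P g M B W \<alpha> p x \<longleftrightarrow>
     (\<forall>i<M. x i \<ge> 0 \<and>
            delivered_price g M B W \<alpha> p x i \<ge> P (\<Sum>j<M. x j) \<and>
            (x i > 0 \<longrightarrow> delivered_price g M B W \<alpha> p x i = P (\<Sum>j<M. x j)))"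

text \<open>
  The masses answering a price vector need not be unique (at \<open>\<alpha> = 1\<close> only their total is
  determined), so an equilibrium is a pair of prices and masses, and a deviation must be
  unprofitable for every mass vector that satisfies the Wardrop conditions after it.
\<close>

definition symmetric_equilibrium ::
  "(real \<Rightarrow> real) \<Rightarrow> (real \<Rightarrow> real) \<Rightarrow> nat \<Rightarrow> (nat \<Rightarrow> real) \<Rightarrow> real \<Rightarrow> real \<Rightarrow>
   (nat \<Rightarrow> real) \<Rightarrow> (nat \<Rightarrow> real) \<Rightarrow> bool"
  where
  "symmetric_equilibrium P g M B W \<alpha> p x \<longleftrightarrow>
     (\<forall>i<M. p i \<ge> 0) \<and>
     (\<forall>i<M. \<forall>j<M. p i = p j) \<and>
     wardrop P g M B W \<alpha> p x \<and>
     (\<forall>i<M. \<forall>p'\<ge>0. \<forall>x'. wardrop P g M B W \<alpha> (p(i := p')) x' \<longrightarrow> p' * x' i \<le> p i * x i)"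

definition total_profit :: "nat \<Rightarrow> (nat \<Rightarrow> real) \<Rightarrow> (nat \<Rightarrow> real) \<Rightarrow> real" where
  "total_profit M p x = (\<Sum>j<M. p j * x j)"

definition social_welfare ::
  "(real \<Rightarrow> real) \<Rightarrow> nat \<Rightarrow> (nat \<Rightarrow> real) \<Rightarrow> (nat \<Rightarrow> real) \<Rightarrow> real" where
  "social_welfare P M p x =
     (let Q = (\<Sum>j<M. x j) in integral {0..Q} (\<lambda>q. P q - P Q) + (\<Sum>j<M. p j * x j))"

text \<open>
  \<open>\<Phi>\<close> and \<open>S\<close> are, as functions of \<open>\<alpha>\<close>, the limits as \<open>W \<rightarrow> \<infinity>\<close> of equilibrium profit and
  equilibrium social welfare. Equilibria are required to exist, and the limits may not depend
  on which equilibrium is selected for each \<open>W\<close>; so \<open>\<Phi>\<close> and \<open>S\<close> are unique on \<open>{0..1}\<close>.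
\<close>

definition unlicensed_limits ::
  "(real \<Rightarrow> real) \<Rightarrow> (real \<Rightarrow> real) \<Rightarrow> nat \<Rightarrow> (nat \<Rightarrow> real) \<Rightarrow>
   (real \<Rightarrow> real) \<Rightarrow> (real \<Rightarrow> real) \<Rightarrow> bool"
  where
  "unlicensed_limits P g M B \<Phi> S \<longleftrightarrow>
     (\<forall>\<alpha>\<in>{0..1}.
        (\<forall>W>0. \<exists>p x. symmetric_equilibrium P g M B W \<alpha> p x) \<and>
        (\<forall>p x. (\<forall>W>0. symmetric_equilibrium P g M B W \<alpha> (p W) (x W)) \<longrightarrow>
           ((\<lambda>W. total_profit M (p W) (x W)) \<longlongrightarrow> \<Phi> \<alpha>) at_top \<and>
           ((\<lambda>W. social_welfare P M (p W) (x W)) \<longlongrightarrow> S \<alpha>) at_top))"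

end

theory Submission imports Defs begin

text \<open>
  In the linear case everything depends only on \<open>k = (1 - \<alpha>)\<^sup>2 M / B\<^sub>t\<close> and
  \<open>s = 1 + \<alpha>\<^sup>2 / W\<close>: with \<open>T = 1 - s \<Sum>x\<^sub>j\<close>, SP \<open>i\<close> serves \<open>(T - p\<^sub>i)\<^sup>+ / k\<close>. As long as all
  SPs are served, the profit is a concave quadratic in the deviating price; if a deviation drives
  rivals out, the quadratic still bounds it from above. Hence there is exactly one symmetric
  equilibrium price, \<open>k / (s (M - 1) + 2 k)\<close>, which continues to hold in the Bertrand
  limit \<open>k = 0\<close> for \<open>M \<ge> 2\<close>.

  Write \<open>y = (1 - \<alpha>)\<^sup>2 / B\<^sub>t\<close> and \<open>u = 1 / (1 + 2 y)\<close>. As \<open>W \<rightarrow> \<infinity>\<close> and then \<open>M \<rightarrow> \<infinity>\<close>, profit tends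
  to \<open>(u - u\<^sup>2) / 2\<close> and welfare to \<open>u / 2\<close>, uniformly in \<open>\<alpha>\<close> with error \<open>O(1 / M)\<close>. Here \<open>u\<close> ranges
  over \<open>[B\<^sub>t / (B\<^sub>t + 2), 1]\<close>; welfare is maximal at \<open>u = 1\<close> and profit at the point \<open>v\<close> of
  the interval closest to \<open>1 / 2\<close>. Since the limiting profit at \<open>u\<close> falls short of the maximum by
  at least \<open>(u - v)\<^sup>2 / 2\<close>, maximizers for finite \<open>M\<close> converge to \<open>v\<close>, and the gap is \<open>(1 - v) / 2\<close>.
\<close>

section \<open>Reduction of the linear case to two parameters \<open>k\<close> and
  \<open>s\<close>\<close>

text \<open>The unlicensed congestion cost is the same for all SPs, so it is moved to the demand
  side, where it steepens the inverse demand to slope \<open>s\<close>. What remains on the supply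
  side is each SP's own licensed congestion, of slope \<open>k\<close>.\<close>

definition wardrop_masses :: "real \<Rightarrow> real \<Rightarrow> nat \<Rightarrow> (nat \<Rightarrow> real) \<Rightarrow> (nat \<Rightarrow> real) \<Rightarrow> bool" where
  "wardrop_masses k s M p x \<longleftrightarrow>
     (\<forall>i<M. 0 \<le> x i \<and> 1 - s * (\<Sum>j<M. x j) \<le> p i + k * x i \<and>
            (0 < x i \<longrightarrow> p i + k * x i = 1 - s * (\<Sum>j<M. x j)))"

definition linear_equilibrium :: "real \<Rightarrow> real \<Rightarrow> nat \<Rightarrow> (nat \<Rightarrow> real) \<Rightarrow> (nat \<Rightarrow> real) \<Rightarrow> bool" where
  "linear_equilibrium k s M p x \<longleftrightarrow>
     (\<forall>i<M. 0 \<le> p i) \<and> (\<forall>i<M. \<forall>j<M. p i = p j) \<and> wardrop_masses k s M p x \<and>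
     (\<forall>i<M. \<forall>p'\<ge>0. \<forall>x'. wardrop_masses k s M (p(i := p')) x' \<longrightarrow> p' * x' i \<le> p i * x i)"

text \<open>For a monopolist without congestion the general formula would read \<open>0 / 0\<close>.\<close>

definition eq_price :: "real \<Rightarrow> real \<Rightarrow> nat \<Rightarrow> real" where
  "eq_price k s M = (if M = 1 then 1 / 2 else k / (s * (real M - 1) + 2 * k))"

text \<open>At a common price \<open>q\<close> each SP serves \<open>(1 - q) / (s M + k)\<close>;
  this is the sum over all SPs at the equilibrium price.\<close>

definition eq_mass :: "real \<Rightarrow> real \<Rightarrow> nat \<Rightarrow> real" where
  "eq_mass k s M = real M * (1 - eq_price k s M) / (s * real M + k)"

lemma symmetric_equilibrium_linear:
  assumes "Bt > 0" and "M \<ge> 1"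
  shows "symmetric_equilibrium (\<lambda>x. 1 - x) (\<lambda>x. x) M (\<lambda>i. Bt / real M) W \<alpha> p x \<longleftrightarrow>
    linear_equilibrium ((1 - \<alpha>)^2 / Bt * real M) (1 + \<alpha>^2 / W) M p x"
proof -
  have "wardrop (\<lambda>x. 1 - x) (\<lambda>x. x) M (\<lambda>i. Bt / real M) W \<alpha> p x \<longleftrightarrow>
    wardrop_masses ((1 - \<alpha>)^2 / Bt * real M) (1 + \<alpha>^2 / W) M p x" for p x
  proof -
    let ?X = "\<Sum>j<M. x j"
    have "delivered_price (\<lambda>x. x) M (\<lambda>i. Bt / real M) W \<alpha> p x i =
      p i + (1 - \<alpha>)^2 / Bt * real M * x i + \<alpha>^2 / W * ?X" for i
      using assms by (simp add: delivered_price_def power2_eq_square mult_ac)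
    moreover have "1 - (1 + \<alpha>^2 / W) * ?X = 1 - ?X - \<alpha>^2 / W * ?X"
      by (simp add: algebra_simps)
    ultimately show ?thesis
      unfolding wardrop_def wardrop_masses_def by (simp add: algebra_simps)
  qed
  then show ?thesis
    unfolding symmetric_equilibrium_def linear_equilibrium_def by simp
qed

section \<open>Equilibrium with licensed congestion, \<open>k > 0\<close>\<close>

text \<open>\<open>T\<close> plays the role of the common delivered price. The equation is the
  market clearing condition \<open>T = 1 - s X\<close> for the total mass \<open>X\<close>,
  multiplied by \<open>k\<close>.\<close>

lemma wardrop_masses_all_served:
  assumes "k > 0" and T: "\<And>j. j < M \<Longrightarrow> p j \<le> T"
    and eq: "k * (1 - T) = s * (\<Sum>j<M. T - p j)"
  shows "wardrop_masses k s M p (\<lambda>j. (T - p j) / k)"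
proof -
  have "s * (\<Sum>j<M. (T - p j) / k) = 1 - T"
    using eq \<open>k > 0\<close> by (simp add: sum_divide_distrib[symmetric] field_simps)
  then show ?thesis
    unfolding wardrop_masses_def using \<open>k > 0\<close> T by simp
qed

lemma sum_others_const:
  assumes "i < M" and "\<And>j. j < M \<Longrightarrow> j \<noteq> i \<Longrightarrow> f j = (c::real)"
  shows "(\<Sum>j<M. f j) = f i + (real M - 1) * c"
proof -
  have "(\<Sum>j<M. f j) = f i + (\<Sum>j\<in>{..<M}-{i}. f j)"
    using assms(1) by (simp add: sum.remove)
  also have "(\<Sum>j\<in>{..<M}-{i}. f j) = (\<Sum>j\<in>{..<M}-{i}. c)"
    using assms(2) by (intro sum.cong) auto
  also have "\<dots> = (real M - 1) * c"
    using assms(1) by (simp add: of_nat_diff)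
  finally show ?thesis .
qed

text \<open>The Wardrop inequalities give \<open>T - p j \<le> k * x j\<close> for every SP, served
  or not, with equality at \<open>i\<close>. Summing them bounds \<open>T\<close> from above, hence
  also \<open>x i\<close>. The bound is affine in \<open>p i\<close>, so the profit of a deviating
  SP lies below a concave quadratic even if rivals lose all customers.\<close>

lemma deviation_mass_le:
  assumes "k > 0" "s > 0" "i < M" and q: "\<And>j. j < M \<Longrightarrow> j \<noteq> i \<Longrightarrow> p j = q"
    and w: "wardrop_masses k s M p x" and "x i > 0"
  shows "k * (s * real M + k) * x i \<le> k + s * (real M - 1) * q - (s * (real M - 1) + k) * p i"
proof -
  define X where "X = (\<Sum>j<M. x j)"
  define T where "T = 1 - s * X"
  have kx: "k * x i = T - p i"
    using w \<open>x i > 0\<close> \<open>i < M\<close> unfolding wardrop_masses_def T_def X_def by fastforce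
  have "(\<Sum>j<M. T - p j) \<le> (\<Sum>j<M. k * x j)"
    using w unfolding wardrop_masses_def T_def X_def
    by (intro sum_mono) (simp add: algebra_simps)
  moreover have "(\<Sum>j<M. T - p j) = (T - p i) + (real M - 1) * (T - q)"
    using q by (intro sum_others_const \<open>i < M\<close>) auto
  ultimately have "(T - p i) + (real M - 1) * (T - q) \<le> k * X"
    by (simp add: X_def sum_distrib_left)
  then have "s * ((T - p i) + (real M - 1) * (T - q)) \<le> s * (k * X)"
    using \<open>s > 0\<close> by simp
  also have "s * (k * X) = k * (1 - T)"
    by (simp add: T_def)
  finally have "(s * real M + k) * T \<le> k + s * (real M - 1) * q + s * p i"
    by (simp add: algebra_simps)
  moreover have "k * (s * real M + k) * x i = (s * real M + k) * (T - p i)"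
    using kx by (metis mult.commute mult.left_commute)
  ultimately show ?thesis
    by (simp add: algebra_simps)
qed

text \<open>If the delivered price \<open>T\<close> did not exceed \<open>q\<close>, nobody would be
  served and \<open>T\<close> would be 1, contradicting \<open>q < 1\<close>. So every SP is served,
  all conditions are equalities, and the linear system has one solution.\<close>

lemma uniform_price_masses:
  assumes "k > 0" "s > 0" "M \<ge> 1" and "q < 1" and p: "\<And>j. j < M \<Longrightarrow> p j = q"
    and w: "wardrop_masses k s M p x" and "i < M"
  shows "x i = (1 - q) / (s * real M + k)"
proof -
  define T where "T = 1 - s * (\<Sum>j<M. x j)"
  have w': "0 \<le> x j" "T \<le> q + k * x j" "0 < x j \<Longrightarrow> q + k * x j = T" if "j < M" for j
    using w p that unfolding wardrop_masses_def T_def by auto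
  have "T > q"
  proof (rule ccontr)
    assume "\<not> T > q"
    then have "x j = 0" if "j < M" for j
      using w'[OF that] \<open>k > 0\<close> mult_pos_pos[of k "x j"] by argo
    then have "T = 1" by (simp add: T_def)
    with \<open>\<not> T > q\<close> \<open>q < 1\<close> show False by simp
  qed
  have kx: "k * x j = T - q" if "j < M" for j
    using w'[OF that] \<open>T > q\<close> by (cases "x j = 0") auto
  then have "(\<Sum>j<M. k * x j) = (\<Sum>j<M. T - q)"
    by (intro sum.cong) auto
  then have "k * (\<Sum>j<M. x j) = real M * (T - q)"
    by (simp add: sum_distrib_left)
  then have "s * (real M * (T - q)) = k * (1 - T)"
    by (simp add: T_def)
  then have "(s * real M + k) * (T - q) = k * (1 - q)"
    by (simp add: algebra_simps)
  then have "k * ((s * real M + k) * x i) = k * (1 - q)"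
    using kx[OF \<open>i < M\<close>] by (metis mult.left_commute)
  then have "(s * real M + k) * x i = 1 - q"
    using \<open>k > 0\<close> by simp
  moreover have "s * real M + k > 0"
    using assms by (simp add: add_nonneg_pos)
  ultimately show ?thesis
    by (simp add: field_simps)
qed

lemma eq_price_pos_k:
  assumes "k > 0" shows "eq_price k s M = k / (s * (real M - 1) + 2 * k)"
  using assms by (simp add: eq_price_def)

lemma eq_price_bounds:
  assumes "k \<ge> 0" "s > 0" "M \<ge> 1"
  shows "0 \<le> eq_price k s M" "eq_price k s M \<le> 1 / 2"
proof -
  have "s * (real M - 1) + 2 * k > 0" if "M \<noteq> 1"
    using assms that by (intro add_pos_nonneg mult_pos_pos) auto
  moreover have "s * (real M - 1) \<ge> 0" using assms by simp
  ultimately show "0 \<le> eq_price k s M" "eq_price k s M \<le> 1 / 2"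
    using assms by (auto simp: eq_price_def field_simps)
qed

text \<open>The price \<open>q\<close> is the stationary point of the quadratic that
  \<open>deviation_mass_le\<close> yields when all rivals charge \<open>q\<close>. Completing the
  square shows that no deviation exceeds the value at \<open>q\<close>, which is the profit actually
  earned there.\<close>

lemma linear_equilibrium_exists_pos:
  assumes "k > 0" "s > 0" "M \<ge> 1"
  shows "\<exists>p x. linear_equilibrium k s M p x"
proof -
  define q where "q = eq_price k s M"
  define C where "C = s * (real M - 1) + k"
  define m where "m = s * real M + k"
  have "C > 0" "m > 0"
    using assms by (auto simp: C_def m_def add_nonneg_pos)
  have q01: "0 \<le> q" "q \<le> 1 / 2"
    using eq_price_bounds[of k s M] assms by (auto simp: q_def)
  \<comment> \<open>This says that the derivative of
    \<open>p' * (k + s * (M - 1) * q - C * p')\<close> vanishes at \<open>p' = q\<close>.\<close>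
  have foc: "k + s * (real M - 1) * q = 2 * C * q"
  proof -
    have "C + k \<noteq> 0"
      using assms \<open>C > 0\<close> by simp
    moreover have "q = k / (C + k)"
      using assms by (simp add: q_def eq_price_pos_k C_def)
    ultimately have "q * (C + k) = k"
      by simp
    then show ?thesis by (simp add: C_def algebra_simps)
  qed
  \<comment> \<open>The delivered price that results when each SP serves
    \<open>(1 - q) / m\<close>.\<close>
  define T where "T = q + k * (1 - q) / m"
  define x where "x = (\<lambda>j::nat. (T - q) / k)"
  have kq: "k * (1 - q) = C * q"
    using foc by (simp add: C_def algebra_simps)
  have x: "x i = (1 - q) / m" for i
    using assms by (simp add: x_def T_def)
  have w: "wardrop_masses k s M (\<lambda>_. q) x"
    unfolding x_def
  proof (rule wardrop_masses_all_served)
    show "q \<le> T" using assms q01 \<open>m > 0\<close> by (simp add: T_def)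
    have "k * (1 - T) = s * (real M * (T - q))"
      using \<open>m > 0\<close> by (simp add: T_def field_simps) (simp add: m_def algebra_simps)
    then show "k * (1 - T) = s * (\<Sum>j<M. T - q)" by simp
  qed fact
  have "p' * x' i \<le> q * x i"
    if i: "i < M" "p' \<ge> 0" and w': "wardrop_masses k s M ((\<lambda>_. q)(i := p')) x'" for i p' x'
  proof (cases "x' i > 0")
    case True
    have "k * m * x' i \<le> 2 * C * q - C * p'"
      using deviation_mass_le[OF assms(1,2) i(1) _ w' True, of q] foc
      by (simp add: m_def C_def)
    then have "p' * (k * m * x' i) \<le> p' * (2 * C * q - C * p')"
      using i by (intro mult_left_mono)
    also have "\<dots> = C * q\<^sup>2 - C * (p' - q)\<^sup>2"
      by (simp add: power2_eq_square algebra_simps)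
    also have "\<dots> \<le> C * q\<^sup>2"
      using \<open>C > 0\<close> by simp
    also have "\<dots> = q * (k * (1 - q))"
      using kq by (simp add: power2_eq_square)
    also have "\<dots> = k * m * (q * x i)"
      using \<open>m > 0\<close> by (simp add: x)
    finally have "(k * m) * (p' * x' i) \<le> (k * m) * (q * x i)"
      by (simp add: mult_ac)
    then show ?thesis using assms \<open>m > 0\<close> by simp
  next
    case False
    then have "p' * x' i \<le> 0" using i by (simp add: mult_nonneg_nonpos)
    also have "0 \<le> q * x i" using q01 \<open>m > 0\<close> by (simp add: x)
    finally show ?thesis .
  qed
  then have "linear_equilibrium k s M (\<lambda>_. q) x"
    unfolding linear_equilibrium_def using w q01 by simp
  then show ?thesis by blast
qed

lemma linear_equilibriumD:
  assumes "linear_equilibrium k s M p x"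
  shows "wardrop_masses k s M p x"
    and "i < M \<Longrightarrow> 0 \<le> p i"
    and "i < M \<Longrightarrow> j < M \<Longrightarrow> p i = p j"
    and "i < M \<Longrightarrow> p' \<ge> 0 \<Longrightarrow> wardrop_masses k s M (p(i := p')) x' \<Longrightarrow> p' * x' i \<le> p i * x i"
  using assms unfolding linear_equilibrium_def by blast+

text \<open>At a common price of at least 1, SP 0 serves nobody and would gain by charging 1/2.
  Below 1 the masses are known from \<open>uniform_price_masses\<close>, and a first-order argument
  for SP 0 determines the price.\<close>

lemma linear_equilibrium_unique_pos:
  assumes "k > 0" "s > 0" "M \<ge> 1" and eq: "linear_equilibrium k s M p x" and "i < M"
  shows "p i = eq_price k s M" "(\<Sum>j<M. x j) = eq_mass k s M"
proof -
  define q where "q = p 0"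
  have p: "p j = q" if "j < M" for j
    using linear_equilibriumD(3)[OF eq that, of 0] \<open>M \<ge> 1\<close> by (simp add: q_def)
  have "q \<ge> 0" and w: "wardrop_masses k s M p x"
    using linear_equilibriumD(1,2)[OF eq] \<open>M \<ge> 1\<close> by (simp_all add: q_def)
  have dev: "p' * x' 0 \<le> q * x 0" if "p' \<ge> 0" "wardrop_masses k s M (p(0 := p')) x'" for p' x'
    using linear_equilibriumD(4)[OF eq _ that] \<open>M \<ge> 1\<close> by (simp add: q_def)
  define C where "C = s * (real M - 1) + k"
  define m where "m = s * real M + k"
  have "C > 0" "m > 0"
    using assms by (auto simp: C_def m_def add_nonneg_pos)
  have "q < 1"
  proof (rule ccontr)
    assume "\<not> q < 1"
    have "x 0 = 0"
    proof (rule ccontr)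
      assume "x 0 \<noteq> 0"
      then have "x 0 > 0" "q + k * x 0 = 1 - s * (\<Sum>j<M. x j)" "(\<Sum>j<M. x j) \<ge> 0"
        using w \<open>M \<ge> 1\<close> p unfolding wardrop_masses_def
        by (force intro: sum_nonneg)+
      moreover have "k * x 0 > 0" "s * (\<Sum>j<M. x j) \<ge> 0" using calculation assms by auto
      ultimately show False using \<open>\<not> q < 1\<close> by linarith
    qed
    \<comment> \<open>After SP 0 deviates to 1/2 it serves the whole market: \<open>X'\<close>
      solves \<open>1 - s X' = 1/2 + k X'\<close>. The rivals, with prices of at least 1, attract no
      customers.\<close>
    define X' where "X' = 1 / (2 * (s + k))"
    define x' where "x' = (\<lambda>j::nat. if j = 0 then X' else 0)"
    have X: "(\<Sum>j<M. x' j) = X'"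
      using \<open>M \<ge> 1\<close> by (simp add: x'_def)
    have "X' > 0" using assms by (simp add: X'_def)
    have "(s + k) * X' = 1 / 2" using assms by (simp add: X'_def)
    then have sk: "1 - s * X' = 1 / 2 + k * X'" by (simp add: algebra_simps)
    have "s * X' > 0" using \<open>X' > 0\<close> \<open>s > 0\<close> by simp
    have "wardrop_masses k s M (p(0 := 1 / 2)) x'"
      unfolding wardrop_masses_def X
    proof (intro allI impI conjI)
      fix j assume "j < M"
      show "0 \<le> x' j" using \<open>X' > 0\<close> by (simp add: x'_def)
      show "1 - s * X' \<le> (p(0 := 1 / 2)) j + k * x' j"
        using sk p[OF \<open>j < M\<close>] \<open>\<not> q < 1\<close> \<open>s * X' > 0\<close> by (auto simp: x'_def)
      show "(p(0 := 1 / 2)) j + k * x' j = 1 - s * X'" if "x' j > 0"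
        using sk that by (auto simp: x'_def split: if_splits)
    qed
    from dev[OF _ this] have "1 / 2 * x' 0 \<le> q * x 0" by simp
    then show False using \<open>x 0 = 0\<close> \<open>X' > 0\<close> by (simp add: x'_def)
  qed
  have x: "x j = (1 - q) / m" if "j < M" for j
    using uniform_price_masses[OF assms(1-3) \<open>q < 1\<close> p w that] by (simp add: m_def)
  text \<open>A small step of the price along the derivative \<open>D\<close> of the (rescaled) profit keeps all
    SPs in business and would raise the profit unless \<open>D = 0\<close>.\<close>
  define D where "D = k * (1 - q) - C * q"
  have "D = 0"
  proof (rule ccontr)
    assume "D \<noteq> 0"
    \<comment> \<open>The first bound keeps the new price \<open>q + u\<close> nonnegative and makes
      \<open>1 - t * C\<close> positive. The second gives
      \<open>\<bar>u\<bar> * m \<le> k * (1 - q)\<close>, which keeps the new delivered price at or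
      above both \<open>q\<close> and \<open>q + u\<close>.\<close>
    define t where "t = min (1 / (2 * C)) (k * (1 - q) / (m * \<bar>D\<bar>))"
    define u where "u = t * D"
    have "t > 0" using \<open>C > 0\<close> \<open>D \<noteq> 0\<close> \<open>m > 0\<close> \<open>k > 0\<close> \<open>q < 1\<close> by (simp add: t_def)
    have tC: "t * C \<le> 1 / 2"
    proof -
      have "t \<le> 1 / (2 * C)" by (simp add: t_def)
      then show ?thesis using \<open>C > 0\<close> by (simp add: field_simps)
    qed
    have um: "\<bar>u\<bar> * m \<le> k * (1 - q)"
    proof -
      have "t \<le> k * (1 - q) / (m * \<bar>D\<bar>)" by (simp add: t_def)
      then have "t * (m * \<bar>D\<bar>) \<le> k * (1 - q)"
        using \<open>m > 0\<close> \<open>D \<noteq> 0\<close> by (simp add: pos_le_divide_eq)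
      then show ?thesis using \<open>t > 0\<close> by (simp add: u_def abs_mult mult_ac)
    qed
    have "m = C + s" by (simp add: m_def C_def algebra_simps)
    have "\<bar>u\<bar> * C \<ge> 0" "\<bar>u\<bar> * s \<ge> 0" using \<open>C > 0\<close> \<open>s > 0\<close> by auto
    moreover have "\<bar>u\<bar> * C + \<bar>u\<bar> * s \<le> k * (1 - q)"
      using um by (simp add: \<open>m = C + s\<close> distrib_left)
    ultimately have us: "\<bar>u\<bar> * s \<le> k * (1 - q)" "\<bar>u\<bar> * C \<le> k * (1 - q)"
      by linarith+
    have "u * s \<ge> - (k * (1 - q))" "u * C \<le> k * (1 - q)"
    proof -
      have "\<bar>u * s\<bar> \<le> k * (1 - q)" "\<bar>u * C\<bar> \<le> k * (1 - q)"
        using us \<open>C > 0\<close> \<open>s > 0\<close> by (simp_all add: abs_mult)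
      then show "u * s \<ge> - (k * (1 - q))" "u * C \<le> k * (1 - q)" by argo+
    qed
    note us = this
    have "q + u \<ge> 0"
    proof -
      have "D \<ge> - (C * q)" using assms \<open>q < 1\<close> by (simp add: D_def)
      then have "u \<ge> t * - (C * q)" unfolding u_def using \<open>t > 0\<close> by (intro mult_left_mono) auto
      moreover have "t * C * q \<le> 1 / 2 * q" using tC \<open>q \<ge> 0\<close> by (rule mult_right_mono)
      ultimately show ?thesis using \<open>q \<ge> 0\<close> by (simp add: mult_ac)
    qed
    \<comment> \<open>The solution of the market clearing equation when SP 0 charges
      \<open>q + u\<close> and all others charge \<open>q\<close>.\<close>
    define T where "T = q + (k * (1 - q) + s * u) / m"
    define p' where "p' = p(0 := q + u)"
    have p': "p' 0 = q + u" "j < M \<Longrightarrow> j \<noteq> 0 \<Longrightarrow> p' j = q" for j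
      using p by (auto simp: p'_def)
    have Tq: "T \<ge> q" using us \<open>m > 0\<close> by (simp add: T_def mult.commute)
    have Tu: "T - (q + u) = (k * (1 - q) - C * u) / m"
      using \<open>m > 0\<close> by (simp add: T_def field_simps) (simp add: \<open>m = C + s\<close> algebra_simps)
    have Tu': "T \<ge> q + u"
    proof -
      have "(k * (1 - q) - C * u) / m \<ge> 0" using us \<open>m > 0\<close> by (simp add: mult.commute)
      then show ?thesis using Tu by simp
    qed
    have "wardrop_masses k s M p' (\<lambda>j. (T - p' j) / k)"
    proof (rule wardrop_masses_all_served)
      show "p' j \<le> T" if "j < M" for j
        using Tq Tu' p' that by (cases "j = 0") auto
      have sum: "(\<Sum>j<M. T - p' j) = (T - p' 0) + (real M - 1) * (T - q)"
        using p' \<open>M \<ge> 1\<close> by (intro sum_others_const) auto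
      have "m * (T - q) = k * (1 - q) + s * u"
        using \<open>m > 0\<close> by (simp add: T_def)
      then show "k * (1 - T) = s * (\<Sum>j<M. T - p' j)"
        unfolding sum p' m_def by (simp add: algebra_simps)
    qed fact
    from dev[OF \<open>q + u \<ge> 0\<close> this[unfolded p'_def], folded p'_def]
    have "(q + u) * ((T - (q + u)) / k) \<le> q * x 0"
      by (simp add: p')
    then have profit_le: "(q + u) * ((k * (1 - q) - C * u) / m / k) \<le> q * ((1 - q) / m)"
      using x[of 0] \<open>M \<ge> 1\<close> Tu by simp
    have "(q + u) * (k * (1 - q) - C * u) \<le> q * (1 - q) * k"
    proof -
      have "(q + u) * (k * (1 - q) - C * u) / (m * k) \<le> q * (1 - q) * k / (m * k)"
        using \<open>m > 0\<close> \<open>k > 0\<close> profit_le by simp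
      then show ?thesis
        using mult_pos_pos[OF \<open>m > 0\<close> \<open>k > 0\<close>] by (simp only: divide_le_cancel)
    qed
    \<comment> \<open>Subtracting the profit at \<open>u = 0\<close> leaves exactly this gain, up to
      the positive factor \<open>m * k\<close>.\<close>
    then have "u * (D - C * u) \<le> 0"
      by (simp add: D_def algebra_simps)
    also have "u * (D - C * u) = t * D\<^sup>2 * (1 - t * C)"
      by (simp add: u_def power2_eq_square algebra_simps)
    finally show False
      using \<open>t > 0\<close> \<open>D \<noteq> 0\<close> tC by (simp add: mult_le_0_iff)
  qed
  then have "q * (s * (real M - 1) + 2 * k) = k"
    by (simp add: D_def C_def algebra_simps)
  moreover have "s * (real M - 1) + 2 * k > 0"
    using \<open>C > 0\<close> \<open>k > 0\<close> by (simp add: C_def)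
  ultimately have q: "q = eq_price k s M"
    using \<open>k > 0\<close> by (simp add: eq_price_pos_k field_simps)
  then show "p i = eq_price k s M" using p \<open>i < M\<close> by simp
  have "(\<Sum>j<M. x j) = (\<Sum>j<M. (1 - q) / m)"
    using x by (intro sum.cong) auto
  then show "(\<Sum>j<M. x j) = eq_mass k s M"
    by (simp add: eq_mass_def q m_def)
qed

section \<open>Equilibrium without licensed congestion, \<open>k = 0\<close>: monopoly and Bertrand
  competition\<close>

lemma wardrop_masses_single:
  assumes "s > 0"
  shows "wardrop_masses 0 s 1 p x \<longleftrightarrow> x 0 = max 0 ((1 - p 0) / s)"
proof -
  have "wardrop_masses 0 s 1 p x \<longleftrightarrow>
      0 \<le> x 0 \<and> (1 - p 0) / s \<le> x 0 \<and> (0 < x 0 \<longrightarrow> x 0 = (1 - p 0) / s)"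
    using assms by (auto simp: wardrop_masses_def field_simps)
  then show ?thesis by (auto simp: max_def)
qed

text \<open>For prices up to 1 the monopoly profit is \<open>p * (1 - p) / s\<close>, and
  \<open>(2 * p - 1)\<^sup>2 \<ge> 0\<close> makes 1/2 its only maximizer. In the forward direction
  it is enough to compare with the deviation to 1/2.\<close>

lemma linear_equilibrium_single:
  assumes "s > 0"
  shows "linear_equilibrium 0 s 1 p x \<longleftrightarrow> p 0 = 1 / 2 \<and> x 0 = 1 / (2 * s)"
proof -
  have max_profit: "p' * max 0 ((1 - p') / s) \<le> 1 / 2 * (1 / (2 * s))" if "p' \<ge> 0" for p'
  proof -
    have "0 \<le> (2 * p' - 1)\<^sup>2" by simp
    then have "p' * (1 - p') \<le> 1 / 4"
      by (simp add: power2_eq_square algebra_simps)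
    then have "p' * (1 - p') / s \<le> 1 / 4 / s"
      using assms by (intro divide_right_mono) auto
    then show ?thesis
      using assms by (simp add: max_def)
  qed
  have "linear_equilibrium 0 s 1 p x \<longleftrightarrow> 0 \<le> p 0 \<and> x 0 = max 0 ((1 - p 0) / s) \<and>
      (\<forall>p'\<ge>0. p' * max 0 ((1 - p') / s) \<le> p 0 * x 0)"
    unfolding linear_equilibrium_def wardrop_masses_single[OF assms] by auto
  also have "\<dots> \<longleftrightarrow> p 0 = 1 / 2 \<and> x 0 = 1 / (2 * s)"
  proof
    assume *: "0 \<le> p 0 \<and> x 0 = max 0 ((1 - p 0) / s) \<and>
      (\<forall>p'\<ge>0. p' * max 0 ((1 - p') / s) \<le> p 0 * x 0)"
    then have "1 / 2 * max 0 ((1 - 1 / 2) / s) \<le> p 0 * max 0 ((1 - p 0) / s)"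
      by (metis zero_le_divide_1_iff zero_le_numeral)
    then have le: "1 / (4 * s) \<le> p 0 * max 0 ((1 - p 0) / s)"
      using assms by (simp add: max_def)
    have "p 0 < 1"
    proof (rule ccontr)
      assume "\<not> p 0 < 1"
      then have "max 0 ((1 - p 0) / s) = 0"
        using assms by (simp add: max_def divide_nonpos_pos zero_le_divide_iff)
      then show False using le assms by simp
    qed
    then have "1 / 4 \<le> p 0 * (1 - p 0)"
      using le assms by (simp add: max_def field_simps)
    then have "(2 * p 0 - 1)\<^sup>2 \<le> 0"
      by (simp add: power2_eq_square algebra_simps)
    then have "p 0 = 1 / 2" by simp
    moreover have "x 0 = 1 / (2 * s)"
      using conjunct1[OF conjunct2[OF *]] assms unfolding \<open>p 0 = 1 / 2\<close> by simp
    ultimately show "p 0 = 1 / 2 \<and> x 0 = 1 / (2 * s)" by simp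
  next
    assume "p 0 = 1 / 2 \<and> x 0 = 1 / (2 * s)"
    then have "p 0 = 1 / 2" "x 0 = 1 / (2 * s)" by auto
    then show "0 \<le> p 0 \<and> x 0 = max 0 ((1 - p 0) / s) \<and>
      (\<forall>p'\<ge>0. p' * max 0 ((1 - p') / s) \<le> p 0 * x 0)"
      using assms max_profit unfolding \<open>p 0 = 1 / 2\<close> \<open>x 0 = 1 / (2 * s)\<close> by simp
  qed
  finally show ?thesis .
qed

text \<open>For \<open>k = 0\<close> the split of the market among cheapest SPs is arbitrary, so all
  customers may go to \<open>i\<close>. A deviation has to be unprofitable for every admissible
  split, so this one can be used against a candidate equilibrium.\<close>

lemma wardrop_masses_undercut:
  assumes "s > 0" "i < M" and "p i = q" "q \<le> 1" and "\<And>j. j < M \<Longrightarrow> q \<le> p j"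
  shows "wardrop_masses 0 s M p (\<lambda>j. if j = i then (1 - q) / s else 0)"
  using assms by (auto simp: wardrop_masses_def)

text \<open>Without congestion the SPs are in Bertrand competition.\<close>

lemma bertrand_exists:
  assumes "s > 0" "M \<ge> 2"
  shows "\<exists>p x. linear_equilibrium 0 s M p x"
proof -
  define x where "x = (\<lambda>j::nat. 1 / (s * real M))"
  have "p' * x' i \<le> 0"
    if i: "i < M" "p' \<ge> 0" and w: "wardrop_masses 0 s M ((\<lambda>_. 0)(i := p')) x'" for i p' x'
  proof -
    \<comment> \<open>A rival of \<open>i\<close>, which still charges 0. It forces the delivered
      price down to at most 0, so a positive deviation price attracts nobody.\<close>
    define j :: nat where "j = (if i = 0 then 1 else 0)"
    have j: "j < M" "j \<noteq> i"
      using \<open>M \<ge> 2\<close> by (auto simp: j_def)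
    have "1 - s * (\<Sum>j<M. x' j) \<le> 0"
      using w j unfolding wardrop_masses_def by fastforce
    moreover have "0 \<le> x' i" "0 < x' i \<longrightarrow> p' = 1 - s * (\<Sum>j<M. x' j)"
      using w i unfolding wardrop_masses_def by fastforce+
    ultimately have "p' = 0 \<or> x' i = 0" using i by linarith
    then show ?thesis by auto
  qed
  moreover have "wardrop_masses 0 s M (\<lambda>_. 0) x"
    using assms by (simp add: wardrop_masses_def x_def)
  ultimately have "linear_equilibrium 0 s M (\<lambda>_. 0) x"
    unfolding linear_equilibrium_def by simp
  then show ?thesis by blast
qed

text \<open>A common price in (0, 1) invites undercutting by an SP with at most half of the market.
  At a price of at least 1, SP 0 serves nobody and gains by charging 1/2. At price 0 the Wardrop
  conditions fix the total mass.\<close>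

lemma bertrand_unique:
  assumes "s > 0" "M \<ge> 2" and eq: "linear_equilibrium 0 s M p x" and "i < M"
  shows "p i = 0" "(\<Sum>j<M. x j) = 1 / s"
proof -
  define q where "q = p 0"
  define X where "X = (\<Sum>j<M. x j)"
  have p: "p j = q" if "j < M" for j
    using linear_equilibriumD(3)[OF eq that, of 0] \<open>M \<ge> 2\<close> by (simp add: q_def)
  have "q \<ge> 0" and w: "wardrop_masses 0 s M p x"
    using linear_equilibriumD(1,2)[OF eq] \<open>M \<ge> 2\<close> by (simp_all add: q_def)
  have x: "0 \<le> x j" "1 - s * X \<le> q" "0 < x j \<Longrightarrow> q = 1 - s * X" if "j < M" for j
    using w p that unfolding wardrop_masses_def X_def by auto
  have "X \<ge> 0" using x unfolding X_def by (intro sum_nonneg) auto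
  have undercut: "p' * (1 - p') \<le> s * (q * x i)" if "0 \<le> p'" "p' \<le> 1" "p' \<le> q" "i < M" for p' i
  proof -
    have "wardrop_masses 0 s M (p(i := p')) (\<lambda>j. if j = i then (1 - p') / s else 0)"
      using that p by (intro wardrop_masses_undercut \<open>s > 0\<close>) auto
    then have "p' * (if i = i then (1 - p') / s else 0) \<le> p i * x i"
      using linear_equilibriumD(4)[OF eq] that by blast
    then show ?thesis
      using \<open>s > 0\<close> p[OF \<open>i < M\<close>] by (simp add: field_simps)
  qed
  have "q = 0"
  proof (rule ccontr)
    assume "q \<noteq> 0"
    show False
    proof (cases "q < 1")
      case True
      \<comment> \<open>One of the first two SPs serves at most half of the customers. Charging
        \<open>q / 2\<close> and taking the whole market would then raise its profit, rescaled by
        \<open>s\<close>, by at least \<open>q\<^sup>2 / 4\<close>.\<close>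
      have "x 0 + x 1 = (\<Sum>j\<in>{0, 1}. x j)" by simp
      also have "\<dots> \<le> X"
        unfolding X_def using \<open>M \<ge> 2\<close> x by (intro sum_mono2) auto
      finally have "x 0 \<le> X / 2 \<or> x 1 \<le> X / 2" by linarith
      then obtain j where j: "j < M" "x j \<le> X / 2"
        using \<open>M \<ge> 2\<close> by (metis less_le_trans one_less_numeral_iff pos2 semiring_norm(76))
      have "s * X \<le> 1 - q"
      proof (cases "X = 0")
        case True
        then show ?thesis using \<open>q < 1\<close> by simp
      next
        case False
        then obtain l where "l < M" "x l \<noteq> 0"
          unfolding X_def by (metis lessThan_iff sum.neutral)
        then have "q = 1 - s * X" using x[of l] by simp
        then show ?thesis by simp
      qed
      moreover have "s * x j \<le> s * (X / 2)"
        using j \<open>s > 0\<close> by (intro mult_left_mono) auto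
      ultimately have "s * x j \<le> (1 - q) / 2" by simp
      then have "q * (s * x j) \<le> q * ((1 - q) / 2)"
        using \<open>q \<ge> 0\<close> by (rule mult_left_mono)
      moreover have "q / 2 * (1 - q / 2) \<le> s * (q * x j)"
        using undercut[of "q / 2" j] j \<open>q \<ge> 0\<close> True by simp
      ultimately have "q * q \<le> 0" by (simp add: algebra_simps)
      then show False using \<open>q \<noteq> 0\<close> by (auto simp: mult_le_0_iff)
    next
      case False
      have "x 0 = 0"
      proof (rule ccontr)
        assume "x 0 \<noteq> 0"
        then have "x 0 > 0" using x[of 0] \<open>M \<ge> 2\<close> by simp
        then have "s * X \<le> 0" using x[of 0] \<open>M \<ge> 2\<close> False by simp
        then have "X = 0" using \<open>s > 0\<close> \<open>X \<ge> 0\<close> by (simp add: mult_le_0_iff)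
        then have "x 0 = 0"
          using x \<open>M \<ge> 2\<close> unfolding X_def by (subst (asm) sum_nonneg_eq_0_iff) auto
        then show False using \<open>x 0 \<noteq> 0\<close> by simp
      qed
      then show False
        using undercut[of "1 / 2" 0] False \<open>M \<ge> 2\<close> by simp
    qed
  qed
  then show "p i = 0" using p \<open>i < M\<close> by simp
  have "X \<noteq> 0"
    using x[OF \<open>i < M\<close>] \<open>q = 0\<close> by auto
  then obtain l where "l < M" "x l \<noteq> 0"
    unfolding X_def by (metis lessThan_iff sum.neutral)
  then have "1 - s * X = 0" using x[of l] \<open>q = 0\<close> by simp
  then show "(\<Sum>j<M. x j) = 1 / s"
    using \<open>s > 0\<close> by (simp add: X_def field_simps)
qed

section \<open>Existence and uniqueness for all \<open>k \<ge> 0\<close>\<close>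

lemma linear_equilibrium_exists:
  assumes "k \<ge> 0" "s > 0" "M \<ge> 1"
  shows "\<exists>p x. linear_equilibrium k s M p x"
proof -
  consider "k > 0" | "k = 0" "M = 1" | "k = 0" "M \<ge> 2" using assms by linarith
  then show ?thesis
  proof cases
    case 2
    have "linear_equilibrium 0 s 1 (\<lambda>_. 1 / 2) (\<lambda>_. 1 / (2 * s))"
      using \<open>s > 0\<close> by (simp add: linear_equilibrium_single del: One_nat_def)
    then show ?thesis using 2 by blast
  qed (use assms linear_equilibrium_exists_pos bertrand_exists in auto)
qed

lemma linear_equilibrium_unique:
  assumes "k \<ge> 0" "s > 0" "i < M" and eq: "linear_equilibrium k s M p x"
  shows "p i = eq_price k s M" "(\<Sum>j<M. x j) = eq_mass k s M"
proof -
  consider "k > 0" | "k = 0" "M = 1" | "k = 0" "M \<ge> 2" using assms by linarith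
  then have "p i = eq_price k s M \<and> (\<Sum>j<M. x j) = eq_mass k s M"
  proof cases
    case 1
    then show ?thesis using linear_equilibrium_unique_pos assms by simp
  next
    case 2
    then show ?thesis
      using eq \<open>s > 0\<close> \<open>i < M\<close> linear_equilibrium_single[of s p x]
      by (simp add: eq_mass_def eq_price_def)
  next
    case 3
    then show ?thesis
      using bertrand_unique[of s M p x i] eq assms
      by (simp add: eq_mass_def eq_price_def)
  qed
  then show "p i = eq_price k s M" "(\<Sum>j<M. x j) = eq_mass k s M" by auto
qed

section \<open>Equilibrium profit and welfare, and their limit for infinite unlicensed
  bandwidth\<close>

definition eq_profit :: "real \<Rightarrow> real \<Rightarrow> nat \<Rightarrow> real" where
  "eq_profit k s M = eq_price k s M * eq_mass k s M"

text \<open>The quadratic term is the consumer surplus, the area of the triangle under the linear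
  inverse demand and above the delivered price.\<close>

definition eq_welfare :: "real \<Rightarrow> real \<Rightarrow> nat \<Rightarrow> real" where
  "eq_welfare k s M = (eq_mass k s M)\<^sup>2 / 2 + eq_profit k s M"

lemma eq_mass_nonneg:
  assumes "k \<ge> 0" "s > 0" "M \<ge> 1"
  shows "eq_mass k s M \<ge> 0"
  using eq_price_bounds[OF assms] assms by (simp add: eq_mass_def)

lemma linear_equilibrium_profit_welfare:
  assumes "k \<ge> 0" "s > 0" "M \<ge> 1" and eq: "linear_equilibrium k s M p x"
  shows "total_profit M p x = eq_profit k s M"
    and "social_welfare (\<lambda>x. 1 - x) M p x = eq_welfare k s M"
proof -
  define Q where "Q = (\<Sum>j<M. x j)"
  have Q: "Q = eq_mass k s M"
    using linear_equilibrium_unique(2)[of k s 0 M p x] assms by (simp add: Q_def)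
  then have "Q \<ge> 0" using eq_mass_nonneg assms by simp
  have "(\<Sum>j<M. p j * x j) = (\<Sum>j<M. eq_price k s M * x j)"
    using linear_equilibrium_unique(1)[OF assms(1,2) _ eq] by (intro sum.cong) auto
  then have profit: "(\<Sum>j<M. p j * x j) = eq_profit k s M"
    by (simp add: eq_profit_def flip: Q sum_distrib_left) (simp add: Q_def)
  then show "total_profit M p x = eq_profit k s M"
    by (simp add: total_profit_def)
  have "((\<lambda>q. 1 - q - (1 - Q)) has_integral (Q * Q - Q\<^sup>2 / 2 - (Q * 0 - 0\<^sup>2 / 2))) {0..Q}"
    using \<open>Q \<ge> 0\<close>
    by (intro fundamental_theorem_of_calculus)
       (auto intro!: derivative_eq_intros simp flip: has_real_derivative_iff_has_vector_derivative)
  then have "integral {0..Q} (\<lambda>q. 1 - q - (1 - Q)) = Q\<^sup>2 / 2"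
    by (simp add: integral_unique power2_eq_square)
  then show "social_welfare (\<lambda>x. 1 - x) M p x = eq_welfare k s M"
    unfolding social_welfare_def Let_def Q_def[symmetric] profit eq_welfare_def Q by simp
qed

text \<open>Continuity is needed twice: in \<open>s\<close>, to let \<open>W\<close> tend to
  infinity, and in \<open>\<alpha>\<close>, to obtain maximizers. Points with \<open>k = 0\<close>
  are included: for \<open>M = 1\<close> the price is constant, and otherwise the denominator stays
  positive.\<close>

lemma eq_price_continuous:
  assumes k: "continuous_on A k" and s: "continuous_on A s"
    and "\<And>z. z \<in> A \<Longrightarrow> k z \<ge> 0" "\<And>z. z \<in> A \<Longrightarrow> s z > 0" "M \<ge> 1"
  shows "continuous_on A (\<lambda>z. eq_price (k z) (s z) M)"
proof (cases "M = 1")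
  case False
  have "s z * (real M - 1) + 2 * k z > 0" if "z \<in> A" for z
    using assms that False by (intro add_pos_nonneg mult_pos_pos) auto
  then show ?thesis
    using False by (auto simp: eq_price_def less_imp_neq[symmetric] intro!: continuous_intros k s)
qed (simp add: eq_price_def)

lemma eq_mass_continuous:
  assumes k: "continuous_on A k" and s: "continuous_on A s"
    and "\<And>z. z \<in> A \<Longrightarrow> k z \<ge> 0" "\<And>z. z \<in> A \<Longrightarrow> s z > 0" "M \<ge> 1"
  shows "continuous_on A (\<lambda>z. eq_mass (k z) (s z) M)"
proof -
  have "s z * real M + k z > 0" if "z \<in> A" for z
    using assms that by (intro add_pos_nonneg mult_pos_pos) auto
  then show ?thesis
    unfolding eq_mass_def
    by (auto simp: less_imp_neq[symmetric] intro!: continuous_intros k s eq_price_continuous assms)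
qed

lemma eq_profit_continuous:
  assumes "continuous_on A k" "continuous_on A s"
    and "\<And>z. z \<in> A \<Longrightarrow> k z \<ge> 0" "\<And>z. z \<in> A \<Longrightarrow> s z > 0" "M \<ge> 1"
  shows "continuous_on A (\<lambda>z. eq_profit (k z) (s z) M)"
  unfolding eq_profit_def
  using assms by (intro continuous_intros eq_price_continuous eq_mass_continuous)

lemma eq_welfare_continuous:
  assumes "continuous_on A k" "continuous_on A s"
    and "\<And>z. z \<in> A \<Longrightarrow> k z \<ge> 0" "\<And>z. z \<in> A \<Longrightarrow> s z > 0" "M \<ge> 1"
  shows "continuous_on A (\<lambda>z. eq_welfare (k z) (s z) M)"
  unfolding eq_welfare_def
  using assms by (intro continuous_intros eq_mass_continuous eq_profit_continuous) auto

text \<open>Price and total mass are unique, so profit and welfare depend only on \<open>k\<close>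
  and \<open>s\<close>, whichever equilibria are selected. Here \<open>k\<close> is independent of
  \<open>W\<close>, and \<open>s = 1 + \<alpha>\<^sup>2 / W\<close> tends to 1.\<close>

lemma unlicensed_limits_linear:
  assumes "Bt > 0" "M \<ge> 1"
  shows "unlicensed_limits (\<lambda>x. 1 - x) (\<lambda>x. x) M (\<lambda>i. Bt / real M)
    (\<lambda>\<alpha>. eq_profit ((1 - \<alpha>)\<^sup>2 / Bt * real M) 1 M)
    (\<lambda>\<alpha>. eq_welfare ((1 - \<alpha>)\<^sup>2 / Bt * real M) 1 M)"
  unfolding unlicensed_limits_def symmetric_equilibrium_linear[OF assms]
proof (intro ballI conjI allI impI)
  fix \<alpha> :: real
  define k where "k = (1 - \<alpha>)\<^sup>2 / Bt * real M"
  have "k \<ge> 0" using assms by (simp add: k_def)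
  have s: "1 + \<alpha>\<^sup>2 / W > 0" if "W > 0" for W
    using that by (simp add: add_pos_nonneg)
  show "\<exists>p x. linear_equilibrium k (1 + \<alpha>\<^sup>2 / W) M p x" if "W > 0" for W
    using linear_equilibrium_exists \<open>k \<ge> 0\<close> s[OF that] \<open>M \<ge> 1\<close> by simp
  fix p x :: "real \<Rightarrow> nat \<Rightarrow> real"
  assume "\<forall>W>0. linear_equilibrium k (1 + \<alpha>\<^sup>2 / W) M (p W) (x W)"
  then have eq: "total_profit M (p W) (x W) = eq_profit k (1 + \<alpha>\<^sup>2 / W) M"
    "social_welfare (\<lambda>x. 1 - x) M (p W) (x W) = eq_welfare k (1 + \<alpha>\<^sup>2 / W) M" if "W > 0" for W
    using linear_equilibrium_profit_welfare[OF \<open>k \<ge> 0\<close> s[OF that] \<open>M \<ge> 1\<close>] that by auto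
  have "((\<lambda>W. 1 + \<alpha>\<^sup>2 / W) \<longlongrightarrow> 1 + 0) at_top"
    by (intro tendsto_intros tendsto_divide_0[OF tendsto_const] filterlim_at_top_imp_at_infinity
        filterlim_ident)
  then have s_lim: "((\<lambda>W. 1 + \<alpha>\<^sup>2 / W) \<longlongrightarrow> 1) at_top" by simp
  have lim: "((\<lambda>W. f (1 + \<alpha>\<^sup>2 / W)) \<longlongrightarrow> f 1) at_top"
    if "continuous_on {0<..} f" for f :: "real \<Rightarrow> real"
    using that continuous_on_eq_continuous_at[of "{0<..}" f]
    by (intro isCont_tendsto_compose[OF _ s_lim]) auto
  have ev: "eventually (\<lambda>W::real. W > 0) at_top" by (rule eventually_gt_at_top)
  have "((\<lambda>W. eq_profit k (1 + \<alpha>\<^sup>2 / W) M) \<longlongrightarrow> eq_profit k 1 M) at_top"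
    using \<open>k \<ge> 0\<close> \<open>M \<ge> 1\<close> by (intro lim eq_profit_continuous continuous_intros) auto
  then show "((\<lambda>W. total_profit M (p W) (x W)) \<longlongrightarrow> eq_profit k 1 M) at_top"
    by (rule Lim_transform_eventually) (use ev in eventually_elim, simp add: eq)
  have "((\<lambda>W. eq_welfare k (1 + \<alpha>\<^sup>2 / W) M) \<longlongrightarrow> eq_welfare k 1 M) at_top"
    using \<open>k \<ge> 0\<close> \<open>M \<ge> 1\<close> by (intro lim eq_welfare_continuous continuous_intros) auto
  then show "((\<lambda>W. social_welfare (\<lambda>x. 1 - x) M (p W) (x W)) \<longlongrightarrow> eq_welfare k 1 M) at_top"
    by (rule Lim_transform_eventually) (use ev in eventually_elim, simp add: eq)
qed

section \<open>Maximizers, and the approximation for many SPs\<close>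

lemma arg_max_exists_continuous:
  fixes f :: "real \<Rightarrow> real"
  assumes "continuous_on {0..1} f"
  shows "\<exists>\<alpha>. is_arg_max f (\<lambda>\<alpha>. \<alpha> \<in> {0..1}) \<alpha>"
proof -
  obtain \<alpha> where "\<alpha> \<in> {0..1}" "\<forall>\<beta>\<in>{0..1}. f \<beta> \<le> f \<alpha>"
    using continuous_attains_sup[OF _ _ assms] by auto
  then show ?thesis by (auto simp: is_arg_max_linorder)
qed

text \<open>With \<open>k = y M\<close>, the price is within \<open>1 / (2 M)\<close> of
  \<open>(1 - u) / 2\<close> and the total mass within \<open>1 / (2 M)\<close> of \<open>u\<close>.
  The bounds do not depend on \<open>y\<close>, so they may be applied at maximizers that vary with
  \<open>M\<close>.\<close>

lemma many_SPs_error: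
  assumes "y \<ge> 0" "M \<ge> 2"
  defines "u \<equiv> 1 / (1 + 2 * y)"
  shows "\<bar>eq_profit (y * real M) 1 M - (u - u\<^sup>2) / 2\<bar> \<le> 1 / real M"
    and "\<bar>eq_welfare (y * real M) 1 M - u / 2\<bar> \<le> 2 / real M"
proof -
  define a where "a = eq_price (y * real M) 1 M"
  define b where "b = eq_mass (y * real M) 1 M"
  define e where "e = 1 / (2 * real M)"
  have u: "0 \<le> u" "u \<le> 1" "y * u = (1 - u) / 2"
    using assms(1) by (auto simp: u_def field_simps)
  have "e > 0" using \<open>M \<ge> 2\<close> by (simp add: e_def)
  have a01: "0 \<le> a" "a \<le> 1"
    using eq_price_bounds[of "y * real M" 1 M] assms by (auto simp: a_def)
  define d where "d = real M - 1 + 2 * (y * real M)"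
  have "d > 0" using assms by (simp add: d_def add_pos_nonneg)
  have a_eq: "a = y * real M / d" using \<open>M \<ge> 2\<close> by (simp add: a_def eq_price_def d_def)
  \<comment> \<open>Since \<open>d = M (1 + 2 y) - 1\<close>, only the term -1 separates the price
    from its limit; the difference is exactly \<open>a * u / M\<close>.\<close>
  have "a * u = (a - (1 - u) / 2) * real M"
  proof -
    have u1: "u * (1 + 2 * y) = 1" using assms by (simp add: u_def)
    have "a * d = y * real M" using a_eq \<open>d > 0\<close> by simp
    then have "real M * (a * (1 + 2 * y) - y) = a"
      by (simp add: d_def algebra_simps)
    then have "u * a = real M * (a * (u * (1 + 2 * y)) - y * u)"
      by (metis (no_types, opaque_lifting) mult.assoc mult.commute right_diff_distrib)
    then show ?thesis unfolding u1 u(3) by (simp add: mult.commute)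
  qed
  then have "a - (1 - u) / 2 = a * u / real M"
    using \<open>M \<ge> 2\<close> by (simp add: field_simps)
  moreover have "0 \<le> a * u" "a * u \<le> 1 / 2"
    using eq_price_bounds[of "y * real M" 1 M] assms u a01 mult_mono[of a "1/2" u 1]
    by (auto simp: a_def)
  ultimately have ae: "\<bar>a - (1 - u) / 2\<bar> \<le> e"
    using \<open>M \<ge> 2\<close> divide_right_mono[of "a * u" "1 / 2" "real M"] by (simp add: e_def)
  have "b = (1 - a) * real M / ((1 + y) * real M)"
    by (simp add: b_def eq_mass_def a_def algebra_simps)
  then have b: "b = (1 - a) / (1 + y)" using \<open>M \<ge> 2\<close> by simp
  then have b01: "0 \<le> b" "b \<le> 1" using a01 assms(1) by auto
  \<comment> \<open>As \<open>u * (1 + y) = (1 + u) / 2\<close>, the error of the mass is that of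
    the price with opposite sign, divided by \<open>1 + y \<ge> 1\<close>.\<close>
  have "(b - u) * (1 + y) = (1 - u) / 2 - a"
  proof -
    have "b * (1 + y) = 1 - a" using b assms(1) by simp
    then show ?thesis using u(3) by (simp add: algebra_simps)
  qed
  then have "\<bar>(b - u) * (1 + y)\<bar> \<le> e"
    using ae by argo
  then have "\<bar>b - u\<bar> * (1 + y) \<le> e"
    using assms(1) by (simp add: abs_mult)
  moreover have "\<bar>b - u\<bar> \<le> \<bar>b - u\<bar> * (1 + y)"
    using assms(1) by (simp add: algebra_simps)
  ultimately have be: "\<bar>b - u\<bar> \<le> e" by linarith
  \<comment> \<open>The profit error splits into the first two of the following products, and the
    welfare error has the third in addition. Each product has one factor of size at most
    \<open>e\<close> and one of size at most 1.\<close>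
  have p1: "\<bar>(a - (1 - u) / 2) * b\<bar> \<le> e"
    using mult_mono[OF ae, of "\<bar>b\<bar>" 1] b01 \<open>e > 0\<close> by (simp add: abs_mult)
  have p2: "\<bar>(1 - u) / 2 * (b - u)\<bar> \<le> e"
    using mult_mono[OF _ be, of "\<bar>(1 - u) / 2\<bar>" 1] u by (simp add: abs_mult)
  have p3: "\<bar>(b + u) / 2 * (b - u)\<bar> \<le> e"
    using mult_mono[OF _ be, of "\<bar>(b + u) / 2\<bar>" 1] u b01 by (simp add: abs_mult)
  have *: "eq_profit (y * real M) 1 M - (u - u\<^sup>2) / 2 = (a - (1 - u) / 2) * b + (1 - u) / 2 * (b - u)"
    by (simp add: eq_profit_def a_def b_def power2_eq_square field_simps)
  show "\<bar>eq_profit (y * real M) 1 M - (u - u\<^sup>2) / 2\<bar> \<le> 1 / real M"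
    unfolding * using p1 p2 by (simp add: e_def)
  have "eq_welfare (y * real M) 1 M - u / 2 =
      (eq_profit (y * real M) 1 M - (u - u\<^sup>2) / 2) + (b + u) / 2 * (b - u)"
    by (simp add: eq_welfare_def b_def power2_eq_square field_simps)
  then show "\<bar>eq_welfare (y * real M) 1 M - u / 2\<bar> \<le> 2 / real M"
    unfolding * using p1 p2 p3 by (simp add: e_def)
qed

section \<open>The welfare gap\<close>

text \<open>\<open>unlicensed_limits\<close> determines \<open>\<Phi> M\<close> and
  \<open>S M\<close> on the unit interval, so the existential quantifier leaves no freedom there.
  Existence of maximizers is stated so that the last clause is not vacuous, and that clause covers
  every selection of maximizers.\<close>

theorem theorem14:
  fixes Bt :: real
  assumes "Bt > 0"
  shows "\<exists>\<Phi> S :: nat \<Rightarrow> real \<Rightarrow> real.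
    (\<forall>M\<ge>1. unlicensed_limits (\<lambda>x. 1 - x) (\<lambda>x. x) M (\<lambda>i. Bt / real M) (\<Phi> M) (S M)) \<and>
    (\<forall>M\<ge>1. (\<exists>\<alpha>. is_arg_max (\<Phi> M) (\<lambda>\<alpha>. \<alpha> \<in> {0..1}) \<alpha>) \<and>
            (\<exists>\<alpha>. is_arg_max (S M) (\<lambda>\<alpha>. \<alpha> \<in> {0..1}) \<alpha>)) \<and>
    (\<forall>\<alpha>profit \<alpha>welfare :: nat \<Rightarrow> real.
       (\<forall>M\<ge>1. is_arg_max (\<Phi> M) (\<lambda>\<alpha>. \<alpha> \<in> {0..1}) (\<alpha>profit M) \<and>
               is_arg_max (S M) (\<lambda>\<alpha>. \<alpha> \<in> {0..1}) (\<alpha>welfare M)) \<longrightarrow>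
       (\<lambda>M. S M (\<alpha>welfare M) - S M (\<alpha>profit M)) \<longlonglongrightarrow> 1 / (2 + max 2 Bt))"
proof -
  define y where "y = (\<lambda>\<alpha>. (1 - \<alpha>)\<^sup>2 / Bt)"
  define \<Phi> where "\<Phi> = (\<lambda>M \<alpha>. eq_profit (y \<alpha> * real M) 1 M)"
  define S where "S = (\<lambda>M \<alpha>. eq_welfare (y \<alpha> * real M) 1 M)"
  define u where "u = (\<lambda>\<alpha>. 1 / (1 + 2 * y \<alpha>))"
  have y0: "y \<alpha> \<ge> 0" for \<alpha> using assms by (simp add: y_def)
  have lims: "unlicensed_limits (\<lambda>x. 1 - x) (\<lambda>x. x) M (\<lambda>i. Bt / real M) (\<Phi> M) (S M)"
    if "M \<ge> 1" for M
    using unlicensed_limits_linear[OF assms that] by (simp add: \<Phi>_def S_def y_def)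
  have cont: "continuous_on {0..1} (\<Phi> M)" "continuous_on {0..1} (S M)" if "M \<ge> 1" for M
  proof -
    have "continuous_on {0..1} y"
      unfolding y_def using assms by (intro continuous_intros) auto
    then show "continuous_on {0..1} (\<Phi> M)" "continuous_on {0..1} (S M)"
      unfolding \<Phi>_def S_def using that y0
      by (intro eq_profit_continuous eq_welfare_continuous continuous_intros; simp)+
  qed
  have err: "\<bar>\<Phi> M \<alpha> - (u \<alpha> - (u \<alpha>)\<^sup>2) / 2\<bar> \<le> 1 / real M" "\<bar>S M \<alpha> - u \<alpha> / 2\<bar> \<le> 2 / real M"
    if "M \<ge> 2" for M \<alpha>
    using many_SPs_error[OF y0 that, of \<alpha>] by (auto simp: \<Phi>_def S_def u_def)
  \<comment> \<open>With this \<open>m\<close>, the value \<open>v\<close> is 1/2 if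
    \<open>Bt \<le> 2\<close> and the left endpoint \<open>Bt / (Bt + 2)\<close> of the range of
    \<open>u\<close> otherwise.\<close>
  define m where "m = max 2 Bt"
  define v where "v = m / (m + 2)"
  \<comment> \<open>Solves \<open>y \<alpha>0 = 1 / m\<close>, that is
    \<open>u \<alpha>0 = v\<close>; it lies in the unit interval because
    \<open>m \<ge> Bt\<close>.\<close>
  define \<alpha>0 where "\<alpha>0 = 1 - sqrt (Bt / m)"
  have m: "m \<ge> 2" "m \<ge> Bt" by (auto simp: m_def)
  have "\<alpha>0 \<in> {0..1}" using m assms by (simp add: \<alpha>0_def)
  have "y \<alpha>0 = 1 / m" using m assms by (simp add: y_def \<alpha>0_def)
  then have "u \<alpha>0 = 1 / (1 + 2 * (1 / m))" by (simp add: u_def)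
  then have u0: "u \<alpha>0 = v" using m by (simp add: v_def field_simps)
  have "u 1 = 1" by (simp add: u_def y_def)
  have u_le_1: "u \<alpha> \<le> 1" for \<alpha> using y0[of \<alpha>] by (simp add: u_def)
  have u_ge: "u \<alpha> \<ge> Bt / (Bt + 2)" if "\<alpha> \<in> {0..1}" for \<alpha>
  proof -
    have "(1 - \<alpha>)\<^sup>2 \<le> 1" using that by (simp add: power_le_one)
    then have "y \<alpha> \<le> 1 / Bt" using assms by (simp add: y_def divide_right_mono)
    then have "u \<alpha> \<ge> 1 / (1 + 2 * (1 / Bt))"
      unfolding u_def using y0[of \<alpha>] by (intro divide_left_mono) (auto intro!: mult_pos_pos add_pos_nonneg simp: assms less_imp_le)
    also have "1 / (1 + 2 * (1 / Bt)) = Bt / (Bt + 2)" using assms by (simp add: field_simps)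
    finally show ?thesis .
  qed
  have gap: "(\<lambda>M. S M (\<alpha>welfare M) - S M (\<alpha>profit M)) \<longlonglongrightarrow> 1 / (2 + max 2 Bt)"
    if max: "\<forall>M\<ge>1. is_arg_max (\<Phi> M) (\<lambda>\<alpha>. \<alpha> \<in> {0..1}) (\<alpha>profit M) \<and>
               is_arg_max (S M) (\<lambda>\<alpha>. \<alpha> \<in> {0..1}) (\<alpha>welfare M)"
    for \<alpha>profit \<alpha>welfare :: "nat \<Rightarrow> real"
  proof -
    have ev: "eventually (\<lambda>M::nat. M \<ge> 2) sequentially" by (rule eventually_ge_at_top)
    have inv: "(\<lambda>M. c / real M) \<longlonglongrightarrow> 0" for c by (rule lim_const_over_n)
    have "\<bar>S M (\<alpha>welfare M) - 1 / 2\<bar> \<le> 2 / real M" if "M \<ge> 2" for M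
    proof -
      \<comment> \<open>Comparison with \<open>\<alpha> = 1\<close>, where \<open>u\<close> attains
        its largest value 1.\<close>
      have "S M 1 \<le> S M (\<alpha>welfare M)" using max that by (auto simp: is_arg_max_linorder)
      then show ?thesis
        using err(2)[OF that, of 1] err(2)[OF that, of "\<alpha>welfare M"] u_le_1[of "\<alpha>welfare M"] \<open>u 1 = 1\<close>
        by argo
    qed
    then have "(\<lambda>M. S M (\<alpha>welfare M) - 1 / 2) \<longlonglongrightarrow> 0"
      by (intro Lim_null_comparison[OF _ inv[of 2]] eventually_mono[OF ev]) auto
    then have W: "(\<lambda>M. S M (\<alpha>welfare M)) \<longlonglongrightarrow> 1 / 2" by (simp add: LIM_zero_iff)
    have sq: "(u (\<alpha>profit M) - v)\<^sup>2 \<le> 4 / real M" if "M \<ge> 2" for M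
    proof -
      define w where "w = u (\<alpha>profit M)"
      have "\<alpha>profit M \<in> {0..1}" and "\<Phi> M \<alpha>0 \<le> \<Phi> M (\<alpha>profit M)"
        using max that \<open>\<alpha>0 \<in> {0..1}\<close> by (auto simp: is_arg_max_linorder)
      then have "v - v\<^sup>2 - (w - w\<^sup>2) \<le> 4 * (1 / real M)"
        using err(1)[OF that, of \<alpha>0, unfolded u0]
          err(1)[OF that, of "\<alpha>profit M", folded w_def] by argo
      then have "v - v\<^sup>2 - (w - w\<^sup>2) \<le> 4 / real M" by simp
      \<comment> \<open>First-order optimality of \<open>v\<close> for \<open>u - u\<^sup>2\<close>:
        either the derivative \<open>1 - 2 * v\<close> is zero, or \<open>v\<close> is the left
        endpoint, at least 1/2, and \<open>w\<close> lies to its right. The exact second-order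
        expansion at \<open>v\<close> then bounds \<open>(w - v)\<^sup>2\<close> by the loss in the
        objective.\<close>
      moreover have "0 \<le> (w - v) * (2 * v - 1)"
      proof (cases "Bt \<le> 2")
        case True
        then show ?thesis by (simp add: v_def m_def)
      next
        case False
        then have "v = Bt / (Bt + 2)" by (simp add: v_def m_def)
        then have "v \<le> w" "v \<ge> 1 / 2"
          using u_ge[OF \<open>\<alpha>profit M \<in> {0..1}\<close>] False unfolding w_def
          by (auto simp: pos_le_divide_eq)
        then show ?thesis by simp
      qed
      moreover have "(w - v)\<^sup>2 = v - v\<^sup>2 - (w - w\<^sup>2) - (w - v) * (2 * v - 1)"
        by (simp add: power2_eq_square algebra_simps)
      ultimately show ?thesis unfolding w_def by linarith
    qed
    have "(\<lambda>M. (u (\<alpha>profit M) - v)\<^sup>2) \<longlonglongrightarrow> 0"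
      by (intro Lim_null_comparison[OF _ inv[of 4]] eventually_mono[OF ev]) (simp add: sq)
    then have "(\<lambda>M. sqrt ((u (\<alpha>profit M) - v)\<^sup>2)) \<longlonglongrightarrow> sqrt 0"
      by (rule tendsto_real_sqrt)
    then have "(\<lambda>M. u (\<alpha>profit M) - v) \<longlonglongrightarrow> 0"
      by (simp add: tendsto_rabs_zero_iff)
    then have U: "(\<lambda>M. u (\<alpha>profit M)) \<longlonglongrightarrow> v" by (simp add: LIM_zero_iff)
    have "(\<lambda>M. S M (\<alpha>profit M) - u (\<alpha>profit M) / 2) \<longlonglongrightarrow> 0"
      by (intro Lim_null_comparison[OF _ inv[of 2]] eventually_mono[OF ev]) (simp add: err)
    then have "(\<lambda>M. (S M (\<alpha>profit M) - u (\<alpha>profit M) / 2) + u (\<alpha>profit M) / 2) \<longlonglongrightarrow> 0 + v / 2"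
      by (intro tendsto_intros U) auto
    then have "(\<lambda>M. S M (\<alpha>welfare M) - S M (\<alpha>profit M)) \<longlonglongrightarrow> 1 / 2 - v / 2"
      by (intro tendsto_diff W) simp
    also have "1 / 2 - v / 2 = 1 / (2 + max 2 Bt)"
      using m by (simp add: v_def flip: m_def) (simp add: field_simps)
    finally show ?thesis .
  qed
  show ?thesis
  proof (rule exI[of _ \<Phi>], rule exI[of _ S], intro conjI allI impI)
    fix M :: nat
    assume "M \<ge> 1"
    then show "unlicensed_limits (\<lambda>x. 1 - x) (\<lambda>x. x) M (\<lambda>i. Bt / real M) (\<Phi> M) (S M)"
      and "\<exists>\<alpha>. is_arg_max (\<Phi> M) (\<lambda>\<alpha>. \<alpha> \<in> {0..1}) \<alpha>"
      and "\<exists>\<alpha>. is_arg_max (S M) (\<lambda>\<alpha>. \<alpha> \<in> {0..1}) \<alpha>"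
      by (intro lims arg_max_exists_continuous cont; assumption)+
  qed (rule gap)
qed

end
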